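(* Let $\mathcal{E}$ be a concrete category over a category $\mathcal{B}$. An object $X\in\mathcal{E}_0$ is Sierpiński (resp. co-Sierpiński) if, and only if, $\mathcal{E}(Y,X)$ is an initial source (resp. $\mathcal{E}(X,Y)$ is a final sink) in $\mathcal{E}$ for all $Y\in\mathcal{E}_0$.
   Context: Concrete categories. A concrete category $\mathcal{E}$ over $\mathcal{B}$ (a faithful functor $|\text{-}|:\mathcal{E}\to\mathcal{B}$, with $\mathcal{E}(X,Y)$ identified with its image) is given by a class $\mathcal{E}_0$ of objects, a function $|\text{-}|:\mathcal{E}_0\to\mathcal{B}_0$, and subsets $\mathcal{E}(X,Y)\subseteq\mathcal{B}(|X|,|Y|)$ with $1_{|X|}\in\mathcal{E}(X,X)$ and $\mathcal{E}(Y,Z)\circ\mathcal{E}(X,Y)\subseteq\mathcal{E}(X,Z)$. A map $f\in\mathcal{B}(|X|,|Y|)$ is an $\mathcal{E}$-morphism if $f\in\mathcal{E}(X,Y)$. A (possibly large, possibly empty) family of $\mathcal{E}$-morphisms $(g_i:Y\to X_i)_{i\in I}$ is an initial source if for any $Z\in\mathcal{E}_0$, a map $f:|Z|\to|Y|$ is an $\mathcal{E}$-morphism $Z\to Y$ as soon as all $g_i\circ f$ are $\mathcal{E}$-morphisms $Z\to X_i$. A family of $\mathcal{E}$-morphisms $(f_i:X_i\to Y)_{i\in I}$ is a final sink if for any $Z\in\mathcal{E}_0$, a map $g:|Y|\to|Z|$ is an $\mathcal{E}$-morphism $Y\to Z$ as soon as all $g\circ f_i$ are $\mathcal{E}$-morphisms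 $X_i\to Z$. The hom-set $\mathcal{E}(Y,X)$ is regarded as the source consisting of all $\mathcal{E}$-morphisms $Y\to X$, and $\mathcal{E}(X,Y)$ as the sink consisting of all $\mathcal{E}$-morphisms $X\to Y$. A full subcategory $\mathcal{D}$ of $\mathcal{E}$ is initially dense (resp. finally dense) if every $Y\in\mathcal{E}_0$ is the domain (resp. codomain) of some initial source $(g_i:Y\to X_i)_{i\in I}$ (resp. final sink $(f_i:X_i\to Y)_{i\in I}$) in $\mathcal{E}$ with all $X_i\in\mathcal{D}_0$. An object $X\in\mathcal{E}_0$ is Sierpiński (resp. co-Sierpiński) if the one-object full subcategory $\{X\}$ is initially dense (resp. finally dense) in $\mathcal{E}$. *)

theory Defs
  imports Main
begin

section \<open>Categories\<close>

text \<open>Classes of objects and of arrows are sets over arbitrary types, so no smallness is imposed.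
  Every arrow has a unique domain and codomain.\<close>

record ('b, 'm) cat =
  Obj :: "'b set"
  Arr :: "'m set"
  Dom :: "'m \<Rightarrow> 'b"
  Cod :: "'m \<Rightarrow> 'b"
  Id :: "'b \<Rightarrow> 'm"
  Comp :: "'m \<Rightarrow> 'm \<Rightarrow> 'm"  (infixl "\<cdot>\<index>" 70)

definition hom :: "('b, 'm, 'x) cat_scheme \<Rightarrow> 'b \<Rightarrow> 'b \<Rightarrow> 'm set" where
  "hom B a b = {f \<in> Arr B. Dom B f = a \<and> Cod B f = b}"

locale category =
  fixes B (structure)
  assumes Dom_in_Obj: "f \<in> Arr B \<Longrightarrow> Dom B f \<in> Obj B"
    and Cod_in_Obj: "f \<in> Arr B \<Longrightarrow> Cod B f \<in> Obj B"
    and Id_in_hom: "a \<in> Obj B \<Longrightarrow> Id B a \<in> hom B a a"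
    and Comp_in_hom: "f \<in> hom B a b \<Longrightarrow> g \<in> hom B b c \<Longrightarrow> g \<cdot> f \<in> hom B a c"
    and Comp_Id_left: "f \<in> hom B a b \<Longrightarrow> Id B b \<cdot> f = f"
    and Comp_Id_right: "f \<in> hom B a b \<Longrightarrow> f \<cdot> Id B a = f"
    and Comp_assoc: "f \<in> hom B a b \<Longrightarrow> g \<in> hom B b c \<Longrightarrow> h \<in> hom B c d \<Longrightarrow>
      (h \<cdot> g) \<cdot> f = h \<cdot> (g \<cdot> f)"

section \<open>Concrete categories\<close>

text \<open>A morphism of the concrete category is identified with its image in the base category.
  Hence the same arrow of the base may be a morphism between several pairs of objects, and
  a morphism does not determine its domain and codomain in the concrete category.\<close>

record ('e, 'b, 'm) concrete_cat =
  EObj :: "'e set"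
  und :: "'e \<Rightarrow> 'b"
  EHom :: "'e \<Rightarrow> 'e \<Rightarrow> 'm set"

locale concrete_category = category B
  for B (structure) +
  fixes E :: "('e, 'b, 'm, 'y) concrete_cat_scheme"
  assumes und_in_Obj: "X \<in> EObj E \<Longrightarrow> und E X \<in> Obj B"
    and EHom_subset: "X \<in> EObj E \<Longrightarrow> Y \<in> EObj E \<Longrightarrow> EHom E X Y \<subseteq> hom B (und E X) (und E Y)"
    and Id_in_EHom: "X \<in> EObj E \<Longrightarrow> Id B (und E X) \<in> EHom E X X"
    and Comp_in_EHom: "X \<in> EObj E \<Longrightarrow> Y \<in> EObj E \<Longrightarrow> Z \<in> EObj E \<Longrightarrow>
      f \<in> EHom E X Y \<Longrightarrow> g \<in> EHom E Y Z \<Longrightarrow> g \<cdot> f \<in> EHom E X Z"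

section \<open>Initial sources and final sinks\<close>

definition initial_source ::
  "('b, 'm, 'x) cat_scheme \<Rightarrow> ('e, 'b, 'm, 'y) concrete_cat_scheme \<Rightarrow>
    'e \<Rightarrow> 'i set \<Rightarrow> ('i \<Rightarrow> 'e) \<Rightarrow> ('i \<Rightarrow> 'm) \<Rightarrow> bool" where
  "initial_source B E Y I X g \<longleftrightarrow>
    Y \<in> EObj E \<and> (\<forall>i\<in>I. X i \<in> EObj E \<and> g i \<in> EHom E Y (X i)) \<and>
    (\<forall>Z\<in>EObj E. \<forall>f\<in>hom B (und E Z) (und E Y).
      (\<forall>i\<in>I. g i \<cdot>\<^bsub>B\<^esub> f \<in> EHom E Z (X i)) \<longrightarrow> f \<in> EHom E Z Y)"

definition final_sink ::
  "('b, 'm, 'x) cat_scheme \<Rightarrow> ('e, 'b, 'm, 'y) concrete_cat_scheme \<Rightarrow>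
    'e \<Rightarrow> 'i set \<Rightarrow> ('i \<Rightarrow> 'e) \<Rightarrow> ('i \<Rightarrow> 'm) \<Rightarrow> bool" where
  "final_sink B E Y I X f \<longleftrightarrow>
    Y \<in> EObj E \<and> (\<forall>i\<in>I. X i \<in> EObj E \<and> f i \<in> EHom E (X i) Y) \<and>
    (\<forall>Z\<in>EObj E. \<forall>g\<in>hom B (und E Y) (und E Z).
      (\<forall>i\<in>I. g \<cdot>\<^bsub>B\<^esub> f i \<in> EHom E (X i) Z) \<longrightarrow> g \<in> EHom E Y Z)"

section \<open>Density and Sierpinski objects\<close>

text \<open>A full subcategory is given by its class \<open>D\<close> of objects.

  HOL cannot quantify over the index type of a family inside a formula. The families
  below are therefore indexed by sets of pairs (object, morphism). This loses no generality:
  a family of any index type can be replaced by its range, as shown by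
  \<open>initially_denseI\<close> and \<open>finally_denseI\<close>.\<close>

definition initially_dense ::
  "('b, 'm, 'x) cat_scheme \<Rightarrow> ('e, 'b, 'm, 'y) concrete_cat_scheme \<Rightarrow> 'e set \<Rightarrow> bool" where
  "initially_dense B E D \<longleftrightarrow> D \<subseteq> EObj E \<and>
    (\<forall>Y\<in>EObj E. \<exists>(I :: ('e \<times> 'm) set) X g.
      initial_source B E Y I X g \<and> (\<forall>i\<in>I. X i \<in> D))"

definition finally_dense ::
  "('b, 'm, 'x) cat_scheme \<Rightarrow> ('e, 'b, 'm, 'y) concrete_cat_scheme \<Rightarrow> 'e set \<Rightarrow> bool" where
  "finally_dense B E D \<longleftrightarrow> D \<subseteq> EObj E \<and>
    (\<forall>Y\<in>EObj E. \<exists>(I :: ('e \<times> 'm) set) X f.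
      final_sink B E Y I X f \<and> (\<forall>i\<in>I. X i \<in> D))"

lemma initially_denseI:
  fixes B :: "('b, 'm, 'x) cat_scheme" and E :: "('e, 'b, 'm, 'y) concrete_cat_scheme"
  assumes "D \<subseteq> EObj E"
    and "\<And>Y. Y \<in> EObj E \<Longrightarrow>
      \<exists>(I :: 'i set) X g. initial_source B E Y I X g \<and> (\<forall>i\<in>I. X i \<in> D)"
  shows "initially_dense B E D"
  unfolding initially_dense_def
proof (intro conjI ballI)
  fix Y assume "Y \<in> EObj E"
  then obtain I :: "'i set" and X g
    where s: "initial_source B E Y I X g" and D: "\<forall>i\<in>I. X i \<in> D"
    using assms(2) by blast
  have "initial_source B E Y ((\<lambda>i. (X i, g i)) ` I) fst snd"
    using s by (simp add: initial_source_def)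
  moreover have "\<forall>p\<in>(\<lambda>i. (X i, g i)) ` I. fst p \<in> D"
    using D by simp
  ultimately show "\<exists>(I :: ('e \<times> 'm) set) X g. initial_source B E Y I X g \<and> (\<forall>i\<in>I. X i \<in> D)"
    by blast
qed (fact assms(1))

lemma finally_denseI:
  fixes B :: "('b, 'm, 'x) cat_scheme" and E :: "('e, 'b, 'm, 'y) concrete_cat_scheme"
  assumes "D \<subseteq> EObj E"
    and "\<And>Y. Y \<in> EObj E \<Longrightarrow>
      \<exists>(I :: 'i set) X f. final_sink B E Y I X f \<and> (\<forall>i\<in>I. X i \<in> D)"
  shows "finally_dense B E D"
  unfolding finally_dense_def
proof (intro conjI ballI)
  fix Y assume "Y \<in> EObj E"
  then obtain I :: "'i set" and X f
    where s: "final_sink B E Y I X f" and D: "\<forall>i\<in>I. X i \<in> D"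
    using assms(2) by blast
  have "final_sink B E Y ((\<lambda>i. (X i, f i)) ` I) fst snd"
    using s by (simp add: final_sink_def)
  moreover have "\<forall>p\<in>(\<lambda>i. (X i, f i)) ` I. fst p \<in> D"
    using D by simp
  ultimately show "\<exists>(I :: ('e \<times> 'm) set) X f. final_sink B E Y I X f \<and> (\<forall>i\<in>I. X i \<in> D)"
    by blast
qed (fact assms(1))

definition sierpinski ::
  "('b, 'm, 'x) cat_scheme \<Rightarrow> ('e, 'b, 'm, 'y) concrete_cat_scheme \<Rightarrow> 'e \<Rightarrow> bool" where
  "sierpinski B E X \<longleftrightarrow> initially_dense B E {X}"

definition co_sierpinski ::
  "('b, 'm, 'x) cat_scheme \<Rightarrow> ('e, 'b, 'm, 'y) concrete_cat_scheme \<Rightarrow> 'e \<Rightarrow> bool" where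
  "co_sierpinski B E X \<longleftrightarrow> finally_dense B E {X}"

text \<open>A hom-set, regarded as a source or sink, is the family indexed by itself.\<close>

definition hom_initial_source ::
  "('b, 'm, 'x) cat_scheme \<Rightarrow> ('e, 'b, 'm, 'y) concrete_cat_scheme \<Rightarrow> 'e \<Rightarrow> 'e \<Rightarrow> bool" where
  "hom_initial_source B E Y X \<longleftrightarrow> initial_source B E Y (EHom E Y X) (\<lambda>_. X) (\<lambda>g. g)"

definition hom_final_sink ::
  "('b, 'm, 'x) cat_scheme \<Rightarrow> ('e, 'b, 'm, 'y) concrete_cat_scheme \<Rightarrow> 'e \<Rightarrow> 'e \<Rightarrow> bool" where
  "hom_final_sink B E X Y \<longleftrightarrow> final_sink B E Y (EHom E X Y) (\<lambda>_. X) (\<lambda>f. f)"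

end

theory Submission
  imports Defs
begin

text \<open>Enlarging an initial source by further morphisms out of its domain keeps it initial:
  the condition that all composites \<open>g\<^sub>i \<cdot> f\<close> be morphisms only becomes stronger.
  If \<open>X\<close> is Sierpinski, then \<open>Y\<close> is the domain of an initial source all of whose members are
  morphisms from \<open>Y\<close> to \<open>X\<close>. The hom-set from \<open>Y\<close> to \<open>X\<close> is the largest source of this kind, so
  it is initial too. Conversely, an initial hom-set is itself a source that witnesses density.
  The co-Sierpinski case is dual.\<close>

text \<open>Inclusion of one family in another is expressed by equality of targets and morphisms,
  because the two index types may differ and a morphism of the base does not determine its
  target in the concrete category.\<close>

lemma initial_source_mono:
  assumes "initial_source B E Y I X g"
    and family: "\<And>j. j \<in> J \<Longrightarrow> X' j \<in> EObj E \<and> g' j \<in> EHom E Y (X' j)"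
    and included: "\<And>i. i \<in> I \<Longrightarrow> \<exists>j\<in>J. X' j = X i \<and> g' j = g i"
  shows "initial_source B E Y J X' g'"
  unfolding initial_source_def
proof (intro conjI ballI impI)
  show "Y \<in> EObj E"
    using assms(1) by (simp add: initial_source_def)
next
  fix Z f
  assume Z: "Z \<in> EObj E" and f: "f \<in> hom B (und E Z) (und E Y)"
    and J: "\<forall>j\<in>J. g' j \<cdot>\<^bsub>B\<^esub> f \<in> EHom E Z (X' j)"
  have "\<forall>i\<in>I. g i \<cdot>\<^bsub>B\<^esub> f \<in> EHom E Z (X i)"
    using J included by metis
  then show "f \<in> EHom E Z Y"
    using assms(1) Z f by (simp add: initial_source_def)
qed (use family in blast)+

lemma final_sink_mono:
  assumes "final_sink B E Y I X f"
    and family: "\<And>j. j \<in> J \<Longrightarrow> X' j \<in> EObj E \<and> f' j \<in> EHom E (X' j) Y"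
    and included: "\<And>i. i \<in> I \<Longrightarrow> \<exists>j\<in>J. X' j = X i \<and> f' j = f i"
  shows "final_sink B E Y J X' f'"
  unfolding final_sink_def
proof (intro conjI ballI impI)
  show "Y \<in> EObj E"
    using assms(1) by (simp add: final_sink_def)
next
  fix Z g
  assume Z: "Z \<in> EObj E" and g: "g \<in> hom B (und E Y) (und E Z)"
    and J: "\<forall>j\<in>J. g \<cdot>\<^bsub>B\<^esub> f' j \<in> EHom E (X' j) Z"
  have "\<forall>i\<in>I. g \<cdot>\<^bsub>B\<^esub> f i \<in> EHom E (X i) Z"
    using J included by metis
  then show "g \<in> EHom E Y Z"
    using assms(1) Z g by (simp add: final_sink_def)
qed (use family in blast)+

lemma sierpinski_iff_hom_initial_source:
  fixes B :: "('b, 'm, 'x) cat_scheme"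
    and E :: "('e, 'b, 'm, 'y) concrete_cat_scheme"
  assumes X: "X \<in> EObj E"
  shows "sierpinski B E X \<longleftrightarrow> (\<forall>Y\<in>EObj E. hom_initial_source B E Y X)"
proof
  assume dense: "sierpinski B E X"
  show "\<forall>Y\<in>EObj E. hom_initial_source B E Y X"
  proof
    fix Y assume "Y \<in> EObj E"
    then obtain I :: "('e \<times> 'm) set" and X' g
      where source: "initial_source B E Y I X' g" and "\<forall>i\<in>I. X' i \<in> {X}"
      using dense unfolding sierpinski_def initially_dense_def by blast
    then have members: "g i \<in> EHom E Y X \<and> X' i = X" if "i \<in> I" for i
      using that by (force simp: initial_source_def)
    from source show "hom_initial_source B E Y X"
      unfolding hom_initial_source_def by (rule initial_source_mono) (use X members in auto)
  qed
next
  assume "\<forall>Y\<in>EObj E. hom_initial_source B E Y X"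
  then show "sierpinski B E X"
    unfolding sierpinski_def hom_initial_source_def
    by (intro initially_denseI) (use X in blast)+
qed

lemma co_sierpinski_iff_hom_final_sink:
  fixes B :: "('b, 'm, 'x) cat_scheme"
    and E :: "('e, 'b, 'm, 'y) concrete_cat_scheme"
  assumes X: "X \<in> EObj E"
  shows "co_sierpinski B E X \<longleftrightarrow> (\<forall>Y\<in>EObj E. hom_final_sink B E X Y)"
proof
  assume dense: "co_sierpinski B E X"
  show "\<forall>Y\<in>EObj E. hom_final_sink B E X Y"
  proof
    fix Y assume "Y \<in> EObj E"
    then obtain I :: "('e \<times> 'm) set" and X' f
      where sink: "final_sink B E Y I X' f" and "\<forall>i\<in>I. X' i \<in> {X}"
      using dense unfolding co_sierpinski_def finally_dense_def by blast
    then have members: "f i \<in> EHom E X Y \<and> X' i = X" if "i \<in> I" for i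
      using that by (force simp: final_sink_def)
    from sink show "hom_final_sink B E X Y"
      unfolding hom_final_sink_def by (rule final_sink_mono) (use X members in auto)
  qed
next
  assume "\<forall>Y\<in>EObj E. hom_final_sink B E X Y"
  then show "co_sierpinski B E X"
    unfolding co_sierpinski_def hom_final_sink_def
    by (intro finally_denseI) (use X in blast)+
qed

theorem proposition5p7:
  fixes B :: "('b, 'm, 'x) cat_scheme"
    and E :: "('e, 'b, 'm, 'y) concrete_cat_scheme"
    and X :: 'e
  assumes "concrete_category B E"
    and "X \<in> EObj E"
  shows "(sierpinski B E X \<longleftrightarrow> (\<forall>Y\<in>EObj E. hom_initial_source B E Y X)) \<and>
    (co_sierpinski B E X \<longleftrightarrow> (\<forall>Y\<in>EObj E. hom_final_sink B E X Y))"
  using assms(2) by (simp add: sierpinski_iff_hom_initial_source co_sierpinski_iff_hom_final_sink)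

end
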